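(* Let $n=bm$ where $b$ is even and $m$ is odd. Let $r$ be a nonnegative integer and $k$ an odd positive integer. Suppose $L=[L_{ij}]$ is a latin square of order $n$ indexed by $N_n=\{0,\dots,n-1\}$ such that \[\lfloor L_{ij}/m\rfloor\equiv\lfloor i/m\rfloor+\lfloor j/m\rfloor \pmod b\] for all $j\in N_n$ and all $0\le i<n-mr$. If $km^2r(r-1)<n$, then $L$ has no $k$-plexes.
   Context: A latin square of order $n$ on symbol set $N_n$ is viewed as a set of entries (row, column, symbol). A $k$-plex is a set of $kn$ entries containing exactly $k$ entries from each row and each column, with each symbol occurring exactly $k$ times. *)

theory Defs
  imports "HOL-Number_Theory.Cong"
begin

text \<open>
  A square of order \<open>n\<close> is a function \<open>L\<close> of which only the values \<open>L i j\<close> with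
  \<open>i, j < n\<close> matter; rows, columns and symbols are all indexed by \<open>{..<n}\<close>.
\<close>

definition latin_square :: "nat \<Rightarrow> (nat \<Rightarrow> nat \<Rightarrow> nat) \<Rightarrow> bool" where
  "latin_square n L \<longleftrightarrow>
     (\<forall>i<n. \<forall>j<n. L i j < n) \<and>
     (\<forall>i<n. \<forall>s<n. \<exists>!j. j < n \<and> L i j = s) \<and>
     (\<forall>j<n. \<forall>s<n. \<exists>!i. i < n \<and> L i j = s)"

definition entries :: "nat \<Rightarrow> (nat \<Rightarrow> nat \<Rightarrow> nat) \<Rightarrow> (nat \<times> nat \<times> nat) set" where
  "entries n L = {(i, j, L i j) | i j. i < n \<and> j < n}"

definition is_plex ::
  "nat \<Rightarrow> nat \<Rightarrow> (nat \<Rightarrow> nat \<Rightarrow> nat) \<Rightarrow> (nat \<times> nat \<times> nat) set \<Rightarrow> bool" where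
  "is_plex k n L P \<longleftrightarrow>
     P \<subseteq> entries n L \<and>
     card P = k * n \<and>
     (\<forall>i<n. card {(i', j, s) \<in> P. i' = i} = k) \<and>
     (\<forall>j<n. card {(i, j', s) \<in> P. j' = j} = k) \<and>
     (\<forall>s<n. card {(i, j, s') \<in> P. s' = s} = k)"

end

theory Submission
  imports Defs
begin

text \<open>
  For an entry \<open>(i, j, s)\<close> consider the defect
  \<open>\<lfloor>s/m\<rfloor> - \<lfloor>i/m\<rfloor> - \<lfloor>j/m\<rfloor>\<close>. Over a \<open>k\<close>-plex the defects add up to \<open>- k m b (b - 1) / 2\<close>,
  which is \<open>b/2\<close> modulo \<open>b\<close> as \<open>k\<close>, \<open>m\<close> and \<open>b - 1\<close> are odd. The first \<open>n - m r\<close> rows contribute \<open>0\<close>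
  modulo \<open>b\<close>. In a column \<open>j\<close> these rows use up all symbols whose block is one of the \<open>b - r\<close> blocks
  following that of \<open>j\<close>, so in the last \<open>m r\<close> rows \<open>\<lfloor>s/m\<rfloor> - \<lfloor>j/m\<rfloor>\<close> is modulo \<open>b\<close> one of
  \<open>b - r, \<dots>, b - 1\<close>. As the row blocks there run through exactly these values, each \<open>k m\<close> times, the
  remaining defects add up, modulo \<open>b\<close>, to a number of absolute value at most \<open>k m r (r - 1) / 2 < b/2\<close>.
\<close>

text \<open>Double counting: a plex meets every row, column and symbol \<open>k\<close> times, so
  with \<open>g\<close> a coordinate a sum over its entries becomes a sum over indices.\<close>

lemma sum_constant_fibres:
  fixes h :: "'b \<Rightarrow> 'c::comm_semiring_1"
  assumes "finite S" "finite T" "g ` S \<subseteq> T"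
    and "\<And>y. y \<in> T \<Longrightarrow> card {x \<in> S. g x = y} = k"
  shows "(\<Sum>x\<in>S. h (g x)) = of_nat k * sum h T"
proof -
  have "(\<Sum>x\<in>S. h (g x)) = (\<Sum>y\<in>T. \<Sum>x\<in>{x \<in> S. g x = y}. h (g x))"
    using sum.group[OF assms(1-3), of "\<lambda>x. h (g x)"] by simp
  also have "\<dots> = (\<Sum>y\<in>T. of_nat k * h y)"
    using assms(4) by (intro sum.cong) auto
  finally show ?thesis
    by (simp add: sum_distrib_left)
qed

lemma sum_div_blocks:
  fixes f :: "nat \<Rightarrow> 'a::comm_semiring_1"
  assumes "a \<le> b"
  shows "(\<Sum>i\<in>{a * m..<b * m}. f (i div m)) = of_nat m * sum f {a..<b}"
  using assms
proof (induction b rule: dec_induct)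
  case (step b)
  have "(\<Sum>i\<in>{b * m..<Suc b * m}. f (i div m)) = (\<Sum>i\<in>{b * m..<Suc b * m}. f b)"
    by (intro sum.cong arg_cong[where f = f] refl) (auto intro!: div_nat_eqI simp: mult.commute)
  moreover have "(\<Sum>i\<in>{a * m..<Suc b * m}. f (i div m)) =
      (\<Sum>i\<in>{a * m..<b * m}. f (i div m)) + (\<Sum>i\<in>{b * m..<Suc b * m}. f (i div m))"
    using step.hyps by (intro sum.atLeastLessThan_concat[symmetric]) auto
  ultimately show ?case
    using step by (simp add: algebra_simps)
qed simp

lemma double_sum_int_atLeastLessThan:
  assumes "a \<le> b"
  shows "2 * (\<Sum>i\<in>{a..<b}. int i) = (int b - int a) * (int a + int b - 1)"
  using assms by (induction b rule: dec_induct) (auto simp: algebra_simps)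

lemma
  assumes "is_plex k n L P"
  shows finite_plex: "finite P"
    and plex_entryD: "(i, j, s) \<in> P \<Longrightarrow> i < n \<and> j < n \<and> s = L i j"
    and plex_row_card: "i < n \<Longrightarrow> card {x \<in> P. fst x = i} = k"
    and plex_col_card: "j < n \<Longrightarrow> card {x \<in> P. fst (snd x) = j} = k"
    and plex_sym_card: "s < n \<Longrightarrow> card {x \<in> P. snd (snd x) = s} = k"
proof -
  have sub: "P \<subseteq> entries n L"
    using assms by (simp add: is_plex_def)
  have "entries n L = (\<lambda>(i, j). (i, j, L i j)) ` ({..<n} \<times> {..<n})"
    by (auto simp: entries_def)
  then have "finite (entries n L)"
    by simp
  with sub show "finite P"
    by (rule finite_subset)
  show "(i, j, s) \<in> P \<Longrightarrow> i < n \<and> j < n \<and> s = L i j"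
    using sub by (auto simp: entries_def)
  have "{x \<in> P. fst x = i} = {(i', j, s) \<in> P. i' = i}"
    "{x \<in> P. fst (snd x) = j} = {(i, j', s) \<in> P. j' = j}"
    "{x \<in> P. snd (snd x) = s} = {(i, j, s') \<in> P. s' = s}"
    by auto
  then show "i < n \<Longrightarrow> card {x \<in> P. fst x = i} = k"
    "j < n \<Longrightarrow> card {x \<in> P. fst (snd x) = j} = k"
    "s < n \<Longrightarrow> card {x \<in> P. snd (snd x) = s} = k"
    using assms by (simp_all add: is_plex_def)
qed

text \<open>Were the offset \<open>q\<close> less than \<open>b - r\<close>, row block
  \<open>q\<close> would lie above the last \<open>m * r\<close> rows. Its \<open>m\<close> rows
  would fill column \<open>j\<close> with \<open>m\<close> distinct symbols from the block of
  \<open>L i j\<close>, hence with all of them, so \<open>L i j\<close> would occur twice in that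
  column.\<close>

lemma last_rows_symbol_offset:
  fixes n b m r :: nat
  assumes n: "n = b * m" and "latin_square n L"
    and step: "\<And>i j. i < n - m * r \<Longrightarrow> j < n \<Longrightarrow>
           [L i j div m = i div m + j div m] (mod b)"
    and "m > 0" "r \<le> b" and i: "n - m * r \<le> i" "i < n" and j: "j < n"
  shows "int b - int r \<le> (int (L i j div m) - int (j div m)) mod int b"
proof (rule ccontr)
  assume neg: "\<not> ?thesis"
  define s where "s = L i j"
  define q where "q = nat ((int (s div m) - int (j div m)) mod int b)"
  have "s < n"
    using assms by (auto simp: s_def latin_square_def)
  then have sb: "s div m < b"
    using n by (simp add: less_mult_imp_div_less)
  have q: "int q = (int (s div m) - int (j div m)) mod int b"
    using sb by (simp add: q_def)
  have qb: "q + r < b"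
    using neg q by (simp add: s_def)
  have "[int (q + j div m) = int (s div m)] (mod int b)"
    unfolding of_nat_add q by (simp add: cong_def mod_simps)
  then have qs: "[q + j div m = s div m] (mod b)"
    by (simp only: cong_int_iff)
  have below: "i' < n - m * r" if "i' < Suc q * m" for i'
  proof -
    have "(Suc q + r) * m \<le> b * m"
      using qb by (intro mult_le_mono1) simp
    then show ?thesis
      using that n by (simp add: algebra_simps)
  qed
  let ?I = "{q * m..<Suc q * m}" and ?S = "{s div m * m..<Suc (s div m) * m}"
  have in_S: "L i' j \<in> ?S" if "i' \<in> ?I" for i'
  proof -
    have lt: "i' < n - m * r"
      using that below by simp
    have "i' div m = q"
      using that by (intro div_nat_eqI) (auto simp: mult.commute)
    then have "[L i' j div m = s div m] (mod b)"
      using step[OF lt j] qs cong_trans by metis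
    moreover have "L i' j div m < b"
      using lt j n assms(2) by (auto simp: latin_square_def intro!: less_mult_imp_div_less)
    ultimately have "L i' j div m = s div m"
      using sb cong_less_modulus_unique_nat by blast
    then show ?thesis
      using \<open>m > 0\<close> by (metis atLeastLessThan_iff div_times_less_eq_dividend dividend_less_div_times
          mult_Suc)
  qed
  have uniq: "i1 = i2" if "i1 < n" "i2 < n" "L i1 j = L i2 j" for i1 i2
    using that j assms(2) unfolding latin_square_def by metis
  have "inj_on (\<lambda>i'. L i' j) ?I"
    using below uniq by (intro inj_onI) (meson atLeastLessThan_iff less_le_trans diff_le_self)
  \<comment> \<open>An injection between two sets of size \<open>m\<close> is onto.\<close>
  then have "(\<lambda>i'. L i' j) ` ?I = ?S"
    using in_S by (intro card_subset_eq) (auto simp: card_image)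
  moreover have "s \<in> ?S"
    using \<open>m > 0\<close> by (simp add: dividend_less_div_times add.commute)
  ultimately obtain i' where "i' \<in> ?I" "L i' j = s"
    by (metis (no_types, lifting) imageE)
  then have "i' < n - m * r" "i' = i"
    using below[of i'] uniq[of i' i] i by (auto simp: s_def)
  with i show False
    by simp
qed

theorem theorem2p3:
  fixes n b m r k :: nat and L :: "nat \<Rightarrow> nat \<Rightarrow> nat"
  assumes "n = b * m" and "even b" and "odd m"
    and "odd k"
    and "latin_square n L"
    and "\<And>i j. i < n - m * r \<Longrightarrow> j < n \<Longrightarrow>
           [L i j div m = i div m + j div m] (mod b)"
    and "k * m\<^sup>2 * r * (r - 1) < n"
  shows "\<not> (\<exists>P. is_plex k n L P)"
proof
  assume "\<exists>P. is_plex k n L P"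
  then obtain P where P: "is_plex k n L P" ..
  note entryD = plex_entryD[OF P] and fin = finite_plex[OF P]
  have "m > 0" "k > 0"
    using \<open>odd m\<close> \<open>odd k\<close> by (auto intro: odd_pos)
  have "(k * m * r * (r - 1)) * m < b * m"
    using assms(1,7) by (simp add: power2_eq_square mult_ac)
  then have small: "k * m * r * (r - 1) < b"
    by simp
  \<comment> \<open>This makes \<open>b - r\<close> a genuine difference. For \<open>r\<close> at
    least 2 the factor \<open>k * m * (r - 1)\<close> is at least 1; otherwise \<open>b > 0\<close>
    suffices.\<close>
  have rb: "r \<le> b"
  proof (cases "r \<le> 1")
    case True
    then show ?thesis using small by linarith
  next
    case False
    have "r * 1 \<le> r * (k * m * (r - 1))"
      using False \<open>m > 0\<close> \<open>k > 0\<close> by (intro mult_le_mono2) simp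
    also have "\<dots> = k * m * r * (r - 1)"
      by (simp only: mult_ac)
    finally show ?thesis
      using small by linarith
  qed
  have start: "n - m * r = (b - r) * m"
    using assms(1) by (simp add: algebra_simps)

  define row sym col :: "nat \<times> nat \<times> nat \<Rightarrow> int"
    where "row = (\<lambda>x. int (fst x div m))" and "sym = (\<lambda>x. int (snd (snd x) div m))"
      and "col = (\<lambda>x. int (fst (snd x) div m))"
  define d where "d x = sym x - row x - col x" for x
  \<comment> \<open>Only the symbol-column offset is reduced modulo \<open>b\<close>: in the last
    rows \<open>row\<close> already lies between \<open>b - r\<close> and \<open>b - 1\<close>, so
    the two can be compared as integers.\<close>
  define q where "q x = (sym x - col x) mod int b" for x
  define last where "last = {x \<in> P. n - m * r \<le> fst x}"
  define B where "B = int k * int m * (\<Sum>i<b. int i)"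

  have blocks: "int k * (\<Sum>i<n. int (i div m)) = B"
    using sum_div_blocks[of 0 b int m] assms(1) by (simp add: B_def lessThan_atLeast0)
  have fibres: "(\<Sum>x\<in>P. int (g x div m)) = B"
    if "\<And>i. i < n \<Longrightarrow> card {x \<in> P. g x = i} = k" "\<And>x. x \<in> P \<Longrightarrow> g x < n" for g
    using sum_constant_fibres[of P "{..<n}" g k "\<lambda>i. int (i div m)"] fin that
    by (simp add: blocks image_subset_iff)
  have bounds: "fst x < n" "fst (snd x) < n" "snd (snd x) < n" if "x \<in> P" for x
    using that entryD[of "fst x" "fst (snd x)" "snd (snd x)"] assms(5)
    by (simp_all add: latin_square_def)
  have "sum row P = B"
    unfolding row_def by (rule fibres) (simp_all add: plex_row_card[OF P] bounds)
  moreover have "sum col P = B"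
    unfolding col_def by (rule fibres) (simp_all add: plex_col_card[OF P] bounds)
  moreover have "sum sym P = B"
    unfolding sym_def by (rule fibres) (simp_all add: plex_sym_card[OF P] bounds)
  ultimately have sum_d: "sum d P = - B"
    by (simp add: d_def sum_subtractf)
  have double_B: "2 * B = int k * int m * int b * (int b - 1)"
    using double_sum_int_atLeastLessThan[of 0 b] by (simp add: B_def lessThan_atLeast0)

  have last_card: "card {x \<in> last. fst x = i} = k" if "i \<in> {(b - r) * m..<b * m}" for i
  proof -
    have "{x \<in> last. fst x = i} = {x \<in> P. fst x = i}"
      using that by (auto simp: last_def start)
    then show ?thesis
      using plex_row_card[OF P, of i] that assms(1) by simp
  qed
  have last_img: "fst ` last \<subseteq> {(b - r) * m..<b * m}"
    using bounds by (auto simp: last_def simp flip: assms(1) start)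
  have fin_last: "finite last"
    using fin by (simp add: last_def)
  have last_sum: "(\<Sum>x\<in>last. int (f (fst x div m))) = int k * int m * (\<Sum>i\<in>{b - r..<b}. int (f i))" for f
    using sum_constant_fibres[OF fin_last _ last_img last_card, of "\<lambda>i. int (f (i div m))"]
      sum_div_blocks[of "b - r" b "\<lambda>i. int (f i)" m]
    by simp
  have card_last: "int (card last) = int k * int m * int r"
    using last_sum[of "\<lambda>_. 1"] rb by simp
  have "2 * sum row last = int k * int m * (2 * (\<Sum>i\<in>{b - r..<b}. int i))"
    using last_sum[of "\<lambda>i. i"] by (simp add: row_def)
  also have "\<dots> = int k * int m * int r * (2 * int b - int r - 1)"
    using double_sum_int_atLeastLessThan[of "b - r" b] rb by (simp add: of_nat_diff mult.assoc)
  finally have row_last: "2 * sum row last = int k * int m * int r * (2 * int b - int r - 1)" .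

  have b: "b > 0"
    using small by simp
  have q_lower: "int b - int r \<le> q x" if "x \<in> last" for x
  proof -
    obtain i j s where x: "x = (i, j, s)" by (cases x)
    then have "n - m * r \<le> i" "i < n" "j < n" "s = L i j"
      using that entryD[of i j s] by (auto simp: last_def)
    then show ?thesis
      using last_rows_symbol_offset[OF assms(1,5,6) \<open>m > 0\<close> rb, of i j]
      by (simp add: q_def sym_def col_def x)
  qed
  have q_upper: "q x \<le> int b - 1" for x
    using b by (simp add: q_def)

  \<comment> \<open>\<open>X\<close> is the representative modulo \<open>b\<close> of the total
    defect that is small enough to estimate.\<close>
  define X where "X = sum q last - sum row last"
  have "int b dvd sum d P - X"
  proof -
    have "sum d P = sum d (P - last) + sum d last"
      using fin by (intro sum.subset_diff) (auto simp: last_def)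
    then have "sum d P - X = sum d (P - last) + (\<Sum>x\<in>last. (sym x - col x) - q x)"
      by (simp add: X_def d_def sum_subtractf)
    moreover have "int b dvd d x" if "x \<in> P - last" for x
    proof -
      obtain i j s where x: "x = (i, j, s)" by (cases x)
      then have "i < n - m * r" "j < n" "s = L i j"
        using that entryD[of i j s] by (auto simp: last_def)
      then have "[int (s div m) = int (i div m + j div m)] (mod int b)"
        using assms(6)[of i j] by (simp only: cong_int_iff)
      then show ?thesis
        by (simp add: d_def sym_def row_def col_def x cong_iff_dvd_diff algebra_simps)
    qed
    moreover have "int b dvd (sym x - col x) - q x" for x
      by (simp add: q_def)
    ultimately show ?thesis
      by (auto intro!: dvd_add dvd_sum)
  qed
  \<comment> \<open>Doubling the modulus along with the sums avoids halving \<open>b\<close> and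
    \<open>b * (b - 1)\<close>.\<close>
  then have "2 * int b dvd - 2 * B - 2 * X"
    using mult_dvd_mono[of 2 2 "int b" "- B - X"] by (simp only: sum_d right_diff_distrib mult_minus_left mult_minus_right dvd_refl)
  \<comment> \<open>\<open>2 * B\<close> is \<open>b\<close> times the odd number
    \<open>k * m * (b - 1)\<close>.\<close>
  moreover have "2 * int b dvd 2 * B - int b"
  proof -
    have "even (int k * int m * (int b - 1) - 1)"
      using assms(2,3,4) by simp
    then have "2 * int b dvd (int k * int m * (int b - 1) - 1) * int b"
      by (intro mult_dvd_mono) auto
    then show ?thesis
      unfolding double_B by (simp add: algebra_simps)
  qed
  ultimately have "2 * int b dvd (- 2 * B - 2 * X) + (2 * B - int b)"
    by (rule dvd_add)
  also have "(- 2 * B - 2 * X) + (2 * B - int b) = - (2 * X + int b)"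
    by simp
  finally have dvd: "2 * int b dvd 2 * X + int b"
    by (simp only: dvd_minus_iff)

  \<comment> \<open>By \<open>row_last\<close> the average of \<open>row\<close> over
    \<open>last\<close> is the midpoint of the range from \<open>b - r\<close> to
    \<open>b - 1\<close> of \<open>q\<close>. Hence \<open>2 * X\<close> is at most
    \<open>k * m * r * (r - 1)\<close> in absolute value.\<close>
  have lower: "int k * int m * int r * (int b - int r) \<le> sum q last"
    using sum_mono[of last "\<lambda>_. int b - int r" q] q_lower card_last by simp
  have upper: "sum q last \<le> int k * int m * int r * (int b - 1)"
    using sum_mono[of last q "\<lambda>_. int b - 1"] q_upper card_last by simp
  \<comment> \<open>The case \<open>r = 0\<close>, where the natural number \<open>r - 1\<close> is
    truncated, is harmless since both sides vanish.\<close>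
  have "int k * int m * int r * (int r - 1) = int (k * m * r * (r - 1))"
    by (cases r) (auto simp: algebra_simps)
  also have "\<dots> < int b"
    using small by (simp only: of_nat_less_iff)
  finally have "- int b < 2 * X" "2 * X < int b"
    using lower upper row_last by (auto simp: X_def algebra_simps)
  \<comment> \<open>No multiple of \<open>2 * b\<close> lies strictly between \<open>0\<close> and
    \<open>2 * b\<close>.\<close>
  then have "0 < 2 * X + int b" "2 * X + int b < 2 * int b"
    by linarith+
  then show False
    using dvd zdvd_not_zless by metis
qed

end
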